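(* For any admissible set $A$ of addition chains, the sets $\mathscr{D}^A$ and $\mathscr{D}^A_{st}$ are well-ordered subsets of $\mathbb{R}$, each of order type $\omega^\omega$. In particular, $\mathscr{D}^\ell$, $\mathscr{D}^*$, $\mathscr{D}^\ell_{st}$ and $\mathscr{D}^*_{st}$ are well-ordered of order type $\omega^\omega$.
   Context: An addition chain for a positive integer $n$ is a sequence $(a_0,\ldots,a_r)$ with $a_0=1$, $a_r=n$, and for every $1\le k\le r$ there exist $0\le i,j<k$ with $a_k=a_i+a_j$; $r$ is its length. A star chain is an addition chain such that for every $k\ge1$ there is $i<k$ with $a_k=a_{k-1}+a_i$. For a set $A$ of addition chains, $\ell^A(n)$ is the least length of an addition chain for $n$ belonging to $A$. $\nu_2(n)$ is the number of $1$'s in the binary expansion of $n$. $A$ is admissible if (i) for every $n\ge1$, $\ell^A(n)$ is defined and $\ell^A(n)\le\lfloor\log_2 n\rfloor+\nu_2(n)-1$, and (ii) for every $n\ge 1$, $\ell^A(2n)\le\ell^A(n)+1$. The $A$-defect is $\delta^A(n)=\ell^A(n)-\log_2 n$, and $\mathscr{D}^A=\{\delta^A(n):n\in\mathbb{N}\}$. A positive integer $m$ is $A$-stable if $\ell^A(2^k m)=\ell^A(m)+k$ for all $k\ge0$; $\mathscr{D}^A_{st}$ is the set of defects $\delta^A(m)$ of $A$-stable numbers $m$. The superscripts $\ell$ and $*$ denote the cases where $A$ is the set of all addition chains, respectively the set of all star chains (both are admissible). *)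

theory Defs
  imports Complex_Main
begin

(* A sequence (a_0, ..., a_r) is the list [a_0, ..., a_r]; its length in the sense of addition
   chains is r, one less than the length of the list.  Repetitions and non-monotone sequences
   are allowed. *)

definition addition_chain_for :: "nat \<Rightarrow> nat list \<Rightarrow> bool" where
  "addition_chain_for n c \<longleftrightarrow>
     c \<noteq> [] \<and> hd c = 1 \<and> last c = n \<and>
     (\<forall>k. 1 \<le> k \<and> k < length c \<longrightarrow> (\<exists>i<k. \<exists>j<k. c ! k = c ! i + c ! j))"

definition chain_length :: "nat list \<Rightarrow> nat" where
  "chain_length c = length c - 1"

definition addition_chains :: "nat list set" where
  "addition_chains = {c. \<exists>n. addition_chain_for n c}"

definition star_chains :: "nat list set" where
  "star_chains = {c \<in> addition_chains.
     \<forall>k. 1 \<le> k \<and> k < length c \<longrightarrow> (\<exists>i<k. c ! k = c ! (k - 1) + c ! i)}"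

(* Unspecified if A contains no addition chain for n. *)
definition ell :: "nat list set \<Rightarrow> nat \<Rightarrow> nat" where
  "ell A n = (LEAST r. \<exists>c\<in>A. addition_chain_for n c \<and> chain_length c = r)"

definition nu2 :: "nat \<Rightarrow> nat" where
  "nu2 n = card {i. bit n i}"

definition admissible :: "nat list set \<Rightarrow> bool" where
  "admissible A \<longleftrightarrow>
     A \<subseteq> addition_chains \<and>
     (\<forall>n\<ge>1. (\<exists>c\<in>A. addition_chain_for n c) \<and>
             int (ell A n) \<le> \<lfloor>log 2 (real n)\<rfloor> + int (nu2 n) - 1) \<and>
     (\<forall>n\<ge>1. ell A (2 * n) \<le> ell A n + 1)"

definition defect :: "nat list set \<Rightarrow> nat \<Rightarrow> real" where
  "defect A n = real (ell A n) - log 2 (real n)"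

definition defects :: "nat list set \<Rightarrow> real set" where
  "defects A = {defect A n |n. n \<ge> 1}"

definition stable :: "nat list set \<Rightarrow> nat \<Rightarrow> bool" where
  "stable A m \<longleftrightarrow> m \<ge> 1 \<and> (\<forall>k. ell A (2 ^ k * m) = ell A m + k)"

definition stable_defects :: "nat list set \<Rightarrow> real set" where
  "stable_defects A = {defect A m |m. stable A m}"

(* The ordinal power \<omega>^\<omega>: finitely supported functions f from \<omega> to \<omega>, compared at the
   largest argument where they differ; f stands for the Cantor normal form
   ... + \<omega>^2 * f 2 + \<omega> * f 1 + f 0.  Its field is the set of all finitely supported functions. *)
definition omega_omega :: "(nat \<Rightarrow> nat) rel" where
  "omega_omega = {(f, g). finite {i. f i \<noteq> 0} \<and> finite {i. g i \<noteq> 0} \<and>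
     (f = g \<or> (\<exists>m. f m < g m \<and> (\<forall>i>m. f i = g i)))}"

definition le_on :: "real set \<Rightarrow> real rel" where
  "le_on D = {(x, y). x \<in> D \<and> y \<in> D \<and> x \<le> y}"

definition well_ordered_of_type :: "real set \<Rightarrow> 'a rel \<Rightarrow> bool" where
  "well_ordered_of_type D r \<longleftrightarrow> well_order_on D (le_on D) \<and> (le_on D, r) \<in> ordIso"

end

theory Submission
  imports Defs "HOL-Library.Infinite_Set"
begin

text \<open>
  The map \<open>\<delta> \<mapsto> 2\<^sup>-\<^sup>\<delta>\<close> reverses the order and takes the defect of \<open>n\<close> to the dyadic number
  \<open>n / 2\<^sup>l\<close> with \<open>l = \<ell>(n)\<close>.

  Upper bound: a chain step that is not a doubling increases the sequence by less than a factor of 2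
  on average, as for the Fibonacci numbers, so a bound on the defect bounds the number of such steps
  and hence, as \<open>\<nu>\<^sub>2\<close> is subadditive, also \<open>\<nu>\<^sub>2(n)\<close>. The numbers in \<open>[0, 1]\<close> with at
  most \<open>k\<close> binary digits 1 are ordered, reversely, like a set of ordinals below \<open>\<omega>\<^sup>2\<^sup>k\<close>.

  Lower bound: the dyadic numbers in \<open>[1, 2)\<close> with at most \<open>k + 1\<close> digits 1 contain a reversed copy
  of \<open>\<omega>\<^sup>k\<close>. By admissibility each of them becomes the number of some defect after division
  by one of \<open>2\<^sup>0, \<dots>, 2\<^sup>k\<close>, and as \<open>\<omega>\<^sup>k\<close> is indecomposable one of these
  finitely many classes still contains a copy of \<open>\<omega>\<^sup>k\<close>. Every \<open>n\<close> has a stable multiple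
  \<open>2\<^sup>K n\<close>, so the same argument applies to stable defects.
\<close>

subsection \<open>Growth of addition chains\<close>

lemma nu2_0 [simp]: "nu2 0 = 0"
  by (simp add: nu2_def)

lemma finite_bits_nat [simp]: "finite {i. bit (n::nat) i}"
proof (rule finite_subset)
  show "{i. bit n i} \<subseteq> {..n}"
  proof
    fix i assume "i \<in> {i. bit n i}"
    then have "n div 2 ^ i \<noteq> 0" by (auto simp: bit_iff_odd intro!: Nat.gr0I)
    then have "2 ^ i \<le> n" by (metis div_less not_less)
    then show "i \<in> {..n}" using less_exp[of i] by (simp del: less_exp)
  qed
qed simp

lemma nu2_double [simp]: "nu2 (2 * n) = nu2 n"
proof -
  have "{i. bit (2 * n) i} = Suc ` {i. bit n i}"
  proof (rule set_eqI)
    fix i show "i \<in> {i. bit (2 * n) i} \<longleftrightarrow> i \<in> Suc ` {i. bit n i}"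
      by (cases i) (auto simp: bit_0 bit_Suc)
  qed
  then show ?thesis by (simp add: nu2_def card_image)
qed

lemma nu2_Suc_double [simp]: "nu2 (Suc (2 * n)) = Suc (nu2 n)"
proof -
  have "{i. bit (Suc (2 * n)) i} = insert 0 (Suc ` {i. bit n i})"
  proof (rule set_eqI)
    fix i show "i \<in> {i. bit (Suc (2 * n)) i} \<longleftrightarrow> i \<in> insert 0 (Suc ` {i. bit n i})"
      by (cases i) (auto simp: bit_0 bit_Suc)
  qed
  then show ?thesis by (simp add: nu2_def card_image)
qed

lemma nu2_power_mult [simp]: "nu2 (2 ^ k * n) = nu2 n"
  by (induction k) (simp_all add: mult.assoc)

lemma nu2_add_power: "m < 2 ^ e \<Longrightarrow> nu2 (2 ^ e + m) = Suc (nu2 m)"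
proof (induction e arbitrary: m)
  case 0
  then show ?case using nu2_Suc_double[of 0] by simp
next
  case (Suc e)
  show ?case
  proof (cases "even m")
    case True
    then obtain k where k: "m = 2 * k" by (elim evenE)
    have "2 ^ Suc e + m = 2 * (2 ^ e + k)" using k by simp
    moreover have "nu2 (2 ^ e + k) = Suc (nu2 k)" using Suc k by simp
    ultimately show ?thesis using k by (metis nu2_double)
  next
    case False
    then obtain k where k: "m = 2 * k + 1" by (elim oddE)
    have "2 ^ Suc e + m = Suc (2 * (2 ^ e + k))" using k by simp
    moreover have "nu2 (2 ^ e + k) = Suc (nu2 k)" using Suc k by simp
    ultimately show ?thesis using k by (metis nu2_Suc_double Suc_eq_plus1)
  qed
qed

lemma nu2_Suc: "nu2 (Suc n) \<le> Suc (nu2 n)"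
proof (induction n rule: less_induct)
  case (less n)
  show ?case
  proof (cases "even n")
    case True
    then show ?thesis by (elim evenE) simp
  next
    case False
    then obtain k where k: "n = Suc (2 * k)" by (auto elim: oddE)
    have "Suc n = 2 * Suc k" using k by simp
    then have "nu2 (Suc n) = nu2 (Suc k)" by (metis nu2_double)
    then show ?thesis using less[of k] k by simp
  qed
qed

text \<open>Both summands are halved at once. A carry occurs only when both are odd; it costs at
  most one digit by \<open>nu2_Suc\<close>, while two digits disappear.\<close>

lemma nu2_add: "nu2 (m + n) \<le> nu2 m + nu2 n"
proof (induction m arbitrary: n rule: less_induct)
  case (less m)
  show ?case
  proof (cases "m = 0")
    case False
    obtain a b where a: "m = 2 * a \<or> m = Suc (2 * a)" and b: "n = 2 * b \<or> n = Suc (2 * b)"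
      by (metis evenE oddE Suc_eq_plus1)
    have "a < m" using a False by auto
    then have IH: "nu2 (a + b) \<le> nu2 a + nu2 b" using less by simp
    show ?thesis using a b
    proof (elim disjE)
      assume *: "m = 2 * a" "n = 2 * b"
      then have "m + n = 2 * (a + b)" by simp
      then show ?thesis using IH * by (metis nu2_double)
    next
      assume *: "m = 2 * a" "n = Suc (2 * b)"
      then have "m + n = Suc (2 * (a + b))" by simp
      then have "nu2 (m + n) = Suc (nu2 (a + b))" by (metis nu2_Suc_double)
      then show ?thesis using IH * by simp
    next
      assume *: "m = Suc (2 * a)" "n = 2 * b"
      then have "m + n = Suc (2 * (a + b))" by simp
      then have "nu2 (m + n) = Suc (nu2 (a + b))" by (metis nu2_Suc_double)
      then show ?thesis using IH * by simp
    next
      assume *: "m = Suc (2 * a)" "n = Suc (2 * b)"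
      then have "m + n = 2 * Suc (a + b)" by simp
      then have "nu2 (m + n) = nu2 (Suc (a + b))" by (metis nu2_double)
      then show ?thesis using IH * nu2_Suc[of "a + b"] by simp
    qed
  qed simp
qed

text \<open>Here \<open>x\<close> bounds the largest and \<open>y\<close> the second largest value of the prefix, \<open>d\<close> counts the
  steps that double some earlier element and \<open>f\<close> the others. A doubling multiplies \<open>(x, y)\<close> by 2,
  any other step replaces it by \<open>(x + y, x)\<close>; since \<open>(7/4)\<^sup>2 \<ge> 7/4 + 1\<close>, the potential
  \<open>7/4 x + y\<close> then grows by a factor of at most \<open>7/4\<close>.\<close>

lemma chain_growth_prefix:
  assumes c: "addition_chain_for n c" and "k < length c"
  shows "\<exists>d f x y. d + f = k \<and> (\<forall>i\<le>k. real (c ! i) \<le> x) \<and>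
      (\<forall>i\<le>k. \<forall>j\<le>k. c ! i < c ! j \<longrightarrow> real (c ! i) \<le> y) \<and>
      y \<le> x \<and> x \<le> 2 * y \<and> 7 / 4 * x + y \<le> 9 / 4 * 2 ^ d * (7 / 4) ^ f \<and>
      (\<forall>i\<le>k. nu2 (c ! i) \<le> 2 ^ f)"
  using assms(2)
proof (induction k)
  case 0
  have "c ! 0 = 1" using c by (auto simp: addition_chain_for_def hd_conv_nth)
  then show ?case using nu2_Suc_double[of 0]
    \<comment> \<open>With a single element the clause on \<open>y\<close> is vacuous, so
      \<open>y\<close> may be 1/2, the least value with \<open>x \<le> 2 * y\<close>. The potential
      is then 7/4 + 1/2, the source of the constant 9/4.\<close>
    by (intro exI[of _ 0] exI[of _ "0::nat"] exI[of _ "1::real"] exI[of _ "1/2::real"]) simp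
next
  case (Suc k)
  then obtain d f x y where df: "d + f = k" and x: "\<And>i. i \<le> k \<Longrightarrow> real (c ! i) \<le> x"
    and y: "\<And>i j. i \<le> k \<Longrightarrow> j \<le> k \<Longrightarrow> c ! i < c ! j \<Longrightarrow> real (c ! i) \<le> y"
    and yx: "y \<le> x" "x \<le> 2 * y" and pot: "7 / 4 * x + y \<le> 9 / 4 * 2 ^ d * (7 / 4) ^ f"
    and nu: "\<And>i. i \<le> k \<Longrightarrow> nu2 (c ! i) \<le> 2 ^ f"
    by (metis Suc_lessD)
  have x0: "0 \<le> x" "0 \<le> y" using x[of 0] yx by auto
  obtain i j where ij: "i \<le> k" "j \<le> k" and v: "c ! Suc k = c ! i + c ! j" and le: "c ! i \<le> c ! j"
    using c Suc.prems unfolding addition_chain_for_def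
    by (metis add.commute le_add1 less_Suc_eq_le nat_le_linear plus_1_eq_Suc)
  show ?case
  proof (cases "c ! i = c ! j")
    case True
    have v2: "c ! Suc k = 2 * c ! i" using v True by simp
    have 1: "real (c ! l) \<le> 2 * x" if "l \<le> Suc k" for l
      using that x[of l] x[of i] ij x0 v2 by (cases "l = Suc k") auto
    \<comment> \<open>The invariant \<open>x \<le> 2 * y\<close> is needed here: an element that
      lies below another one of the extended prefix is at most \<open>x\<close>, even if it is the
      new one.\<close>
    have 2: "real (c ! l) \<le> 2 * y" if "l \<le> Suc k" "m \<le> Suc k" "c ! l < c ! m" for l m
    proof (cases "l = Suc k")
      case l: True
      then show ?thesis using that x[of m] yx by (cases "m = Suc k") auto
    next
      case False
      then show ?thesis using that x[of l] yx by auto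
    qed
    have 3: "nu2 (c ! l) \<le> 2 ^ f" if "l \<le> Suc k" for l
      using that nu[of l] nu[of i] ij v2 by (cases "l = Suc k") auto
    show ?thesis
      using 1 2 3 df yx pot
      by (intro exI[of _ "Suc d"] exI[of _ f] exI[of _ "2 * x"] exI[of _ "2 * y"]) auto
  next
    case False
    have vxy: "real (c ! Suc k) \<le> x + y" using v x[of j] y[of i j] ij False le by simp
    have 1: "real (c ! l) \<le> x + y" if "l \<le> Suc k" for l
      using that x[of l] x0 vxy by (cases "l = Suc k") auto
    have 2: "real (c ! l) \<le> x" if "l \<le> Suc k" "m \<le> Suc k" "c ! l < c ! m" for l m
    proof (cases "l = Suc k")
      case l: True
      then show ?thesis using that x[of m] yx by (cases "m = Suc k") auto
    next
      case False
      then show ?thesis using that x[of l] yx by auto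
    qed
    have 3: "nu2 (c ! l) \<le> 2 ^ Suc f" if "l \<le> Suc k" for l
    proof (cases "l = Suc k")
      case True
      then show ?thesis using v nu[OF ij(1)] nu[OF ij(2)] nu2_add[of "c ! i" "c ! j"] by simp
    next
      case False
      then show ?thesis using that nu[of l] by simp
    qed
    have "7 / 4 * (x + y) + x \<le> 7 / 4 * (7 / 4 * x + y)" using x0 by (simp add: field_simps)
    also have "\<dots> \<le> 7 / 4 * (9 / 4 * 2 ^ d * (7 / 4) ^ f)"
      using pot by (rule mult_left_mono) simp
    finally have 4: "7 / 4 * (x + y) + x \<le> 9 / 4 * 2 ^ d * (7 / 4) ^ Suc f" by simp
    show ?thesis
      using 1 2 3 4 df yx x0
      by (intro exI[of _ d] exI[of _ "Suc f"] exI[of _ "x + y"] exI[of _ x]) auto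
  qed
qed

text \<open>Dividing the potential bound by \<open>2 ^ (d + f)\<close> cancels the doublings, and
  each other step leaves a factor 7/8. A lower bound on the ratio thus bounds \<open>f\<close>, and
  with it the number of binary digits 1.\<close>

lemma chain_growth:
  assumes "addition_chain_for n c"
  shows "\<exists>f. real n / 2 ^ chain_length c \<le> 9 / 4 * (7 / 8) ^ f \<and> nu2 n \<le> 2 ^ f"
proof -
  let ?k = "chain_length c"
  have ne: "?k < length c" and n: "n = c ! ?k"
    using assms by (auto simp: addition_chain_for_def chain_length_def last_conv_nth)
  obtain d f x y where *: "d + f = ?k" "\<And>i. i \<le> ?k \<Longrightarrow> real (c ! i) \<le> x"
      "y \<le> x" "x \<le> 2 * y" "7 / 4 * x + y \<le> 9 / 4 * 2 ^ d * (7 / 4) ^ f"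
      "\<And>i. i \<le> ?k \<Longrightarrow> nu2 (c ! i) \<le> 2 ^ f"
    using chain_growth_prefix[OF assms ne] by metis
  have "real n \<le> 9 / 4 * 2 ^ d * (7 / 4) ^ f" using *(2)[of ?k] *(3-5) n by simp
  also have "\<dots> = 9 / 4 * (7 / 8) ^ f * 2 ^ ?k"
    by (simp flip: *(1) add: power_add power_divide field_simps)
       (simp flip: power_mult_distrib)
  finally show ?thesis using *(6)[of ?k] n by (auto simp: field_simps intro!: exI[of _ f])
qed

text \<open>Each step at most doubles the bound on the preceding elements. This places the ratios
  \<open>n / 2 ^ ell A n\<close> in (0, 1] for positive \<open>n\<close>.\<close>

lemma chain_le_power:
  assumes c: "addition_chain_for n c"
  shows "n \<le> 2 ^ chain_length c"
proof -
  have "c ! k \<le> 2 ^ k" if "k < length c" for k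
    using that
  proof (induction k rule: less_induct)
    case (less k)
    show ?case
    proof (cases k)
      case 0
      then show ?thesis using c by (auto simp: addition_chain_for_def hd_conv_nth)
    next
      case (Suc l)
      then obtain i j where ij: "i < k" "j < k" "c ! k = c ! i + c ! j"
        using c less.prems unfolding addition_chain_for_def by (metis One_nat_def Suc_leI zero_less_Suc)
      have "c ! i \<le> 2 ^ l" "c ! j \<le> 2 ^ l"
        using less.IH[of i] less.IH[of j] ij less.prems Suc
        by (meson le_trans less_Suc_eq_le less_trans one_le_numeral power_increasing)+
      then show ?thesis using ij Suc by simp
    qed
  qed
  from this[of "chain_length c"] show ?thesis
    using c by (auto simp: addition_chain_for_def chain_length_def last_conv_nth)
qed

subsection \<open>The ordinal \<open>\<omega>\<^sup>\<omega>\<close>\<close>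

text \<open>\<open>below k\<close> consists of the Cantor normal forms of the ordinals smaller than \<open>\<omega>\<^sup>k\<close>.\<close>

definition below :: "nat \<Rightarrow> (nat \<Rightarrow> nat) set" where
  "below k = {f. \<forall>i\<ge>k. f i = 0}"

text \<open>The strict part of \<open>omega_omega\<close> without the condition on supports.
  Transitivity holds for arbitrary functions; only comparability uses finite support.\<close>

definition lex_less :: "(nat \<Rightarrow> nat) \<Rightarrow> (nat \<Rightarrow> nat) \<Rightarrow> bool" (infix "\<prec>" 50) where
  "f \<prec> g \<longleftrightarrow> (\<exists>m. f m < g m \<and> (\<forall>i>m. f i = g i))"

lemma finite_support_iff_below: "finite {i. f i \<noteq> (0::nat)} \<longleftrightarrow> (\<exists>k. f \<in> below k)"
proof -
  have "(\<forall>i\<in>{i. f i \<noteq> 0}. i < k) \<longleftrightarrow> f \<in> below k" for k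
    unfolding below_def mem_Collect_eq Ball_def by (meson not_less)
  then show ?thesis by (simp only: finite_nat_set_iff_bounded)
qed

lemma omega_omega_eq:
  "omega_omega = {(f, g). f \<in> (\<Union>k. below k) \<and> g \<in> (\<Union>k. below k) \<and> (f = g \<or> f \<prec> g)}"
  unfolding omega_omega_def lex_less_def finite_support_iff_below by simp

lemma Field_omega_omega: "Field omega_omega = (\<Union>k. below k)"
  unfolding omega_omega_eq Field_def by auto

lemma lex_less_irrefl [simp]: "\<not> f \<prec> f"
  by (auto simp: lex_less_def)

lemma lex_less_trans: "f \<prec> g \<Longrightarrow> g \<prec> h \<Longrightarrow> f \<prec> h"
  unfolding lex_less_def
proof (elim exE conjE)
  fix m n
  assume "f m < g m" "\<forall>i>m. f i = g i" "g n < h n" "\<forall>i>n. g i = h i"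
  then show "\<exists>m. f m < h m \<and> (\<forall>i>m. f i = h i)"
    by (intro exI[of _ "max m n"]) (cases m n rule: linorder_cases; auto simp: max_def)
qed

lemma lex_less_linear:
  assumes "f \<in> (\<Union>k. below k)" "g \<in> (\<Union>k. below k)" "f \<noteq> g"
  shows "f \<prec> g \<or> g \<prec> f"
proof -
  let ?D = "{i. f i \<noteq> g i}"
  have "finite ?D"
  proof (rule finite_subset)
    show "?D \<subseteq> {i. f i \<noteq> 0} \<union> {i. g i \<noteq> 0}" by auto
    show "finite ({i. f i \<noteq> 0} \<union> {i. g i \<noteq> 0})"
      using assms by (auto simp only: finite_Un finite_support_iff_below)
  qed
  moreover have "?D \<noteq> {}" using assms(3) by auto
  ultimately obtain m where m: "m \<in> ?D" "\<And>i. i \<in> ?D \<Longrightarrow> i \<le> m"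
    using Max_in Max_ge by meson
  have "f m < g m \<or> g m < f m" using m(1) by auto
  moreover have "f i = g i" if "i > m" for i using m(2)[of i] that by auto
  ultimately show ?thesis unfolding lex_less_def by metis
qed

lemma lex_less_below: "f \<prec> g \<Longrightarrow> g \<in> below k \<Longrightarrow> f \<in> below k"
  unfolding lex_less_def below_def mem_Collect_eq
proof (elim exE conjE, intro allI impI)
  fix m i
  assume m: "f m < g m" "\<forall>i>m. f i = g i" "\<forall>i\<ge>k. g i = 0" and "k \<le> i"
  have "m < k"
  proof (rule ccontr)
    assume "\<not> m < k"
    then have "g m = 0" using m(3) by simp
    then show False using m(1) by simp
  qed
  then show "f i = 0" using m \<open>k \<le> i\<close> by simp
qed

text \<open>This is omega^(k+1) = omega^k * omega: the coefficient at \<open>k\<close> is compared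
  first, then the remainder below omega^k. All inductions on \<open>k\<close> rest on this
  splitting.\<close>

lemma lex_less_upd:
  assumes "f \<in> below k" "g \<in> below k"
  shows "f(k := a) \<prec> g(k := b) \<longleftrightarrow> a < b \<or> a = b \<and> f \<prec> g"
proof
  assume "f(k := a) \<prec> g(k := b)"
  then obtain m where m: "(f(k := a)) m < (g(k := b)) m" "\<forall>i>m. (f(k := a)) i = (g(k := b)) i"
    by (auto simp: lex_less_def)
  show "a < b \<or> a = b \<and> f \<prec> g"
  proof (cases m k rule: linorder_cases)
    case less
    have "f i = g i" if "i > m" for i
      using m(2) that assms by (cases "i = k") (auto simp: below_def)
    then show ?thesis using m less by (auto simp: lex_less_def)
  qed (use m assms in \<open>auto simp: below_def\<close>)
next
  assume R: "a < b \<or> a = b \<and> f \<prec> g"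
  show "f(k := a) \<prec> g(k := b)"
  proof (cases "a < b")
    case True
    then show ?thesis using assms unfolding lex_less_def below_def
      by (intro exI[of _ k]) auto
  next
    case False
    then obtain m where m: "a = b" "f m < g m" "\<forall>i>m. f i = g i" using R by (auto simp: lex_less_def)
    have "m < k"
    proof (rule ccontr)
      assume "\<not> m < k"
      then have "g m = 0" using assms(2) by (simp add: below_def)
      then show False using m(2) by simp
    qed
    then show ?thesis using m unfolding lex_less_def by (intro exI[of _ m]) auto
  qed
qed

lemma below_upd: "f \<in> below (Suc k) \<Longrightarrow> f(k := 0) \<in> below k"
  by (auto simp: below_def)

lemma upd_below: "f \<in> below k \<Longrightarrow> f(k := a) \<in> below (Suc k)"
  by (auto simp: below_def)

lemma below_mono: "k \<le> l \<Longrightarrow> below k \<subseteq> below l"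
  by (auto simp: below_def)

lemma lex_less_Suc:
  assumes "f \<in> below (Suc k)" "g \<in> below (Suc k)"
  shows "f \<prec> g \<longleftrightarrow> f k < g k \<or> f k = g k \<and> f(k := 0) \<prec> g(k := 0)"
  using lex_less_upd[OF below_upd[OF assms(1)] below_upd[OF assms(2)], of "f k" "g k"] by simp

text \<open>Among the members of \<open>Q\<close> below omega^(k+1), first the coefficient at
  \<open>k\<close> is minimised and then, by induction, the remainder. Other members of
  \<open>Q\<close> cannot interfere, since \<open>below (Suc k)\<close> is an initial
  segment.\<close>

lemma below_has_min:
  assumes "Q \<subseteq> (\<Union>k. below k)" "q \<in> Q" "q \<in> below k"
  shows "\<exists>z\<in>Q. \<forall>y\<in>Q. \<not> y \<prec> z"
  using assms
proof (induction k arbitrary: Q q)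
  case 0
  then have "\<not> y \<prec> q" for y by (auto simp: below_def lex_less_def)
  then show ?case using 0 by blast
next
  case (Suc k)
  define m where "m = (LEAST a. \<exists>f\<in>Q \<inter> below (Suc k). f k = a)"
  define P where "P = {f(k := 0) |f. f \<in> Q \<inter> below (Suc k) \<and> f k = m}"
  have "\<exists>f\<in>Q \<inter> below (Suc k). f k = m"
    unfolding m_def by (rule LeastI_ex) (use Suc.prems in blast)
  then obtain p where p: "p \<in> Q \<inter> below (Suc k)" "p k = m" by blast
  have mle: "m \<le> f k" if "f \<in> Q \<inter> below (Suc k)" for f
    unfolding m_def using that by (auto intro: Least_le)
  have P_below: "P \<subseteq> below k" unfolding P_def using below_upd by blast
  have "p(k := 0) \<in> P" unfolding P_def using p by blast
  then have "\<exists>z\<in>P. \<forall>y\<in>P. \<not> y \<prec> z"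
    using P_below by (intro Suc.IH[of _ "p(k := 0)"]) blast+
  then obtain z where z: "z \<in> Q \<inter> below (Suc k)" "z k = m" "\<And>y. y \<in> P \<Longrightarrow> \<not> y \<prec> z(k := 0)"
    unfolding P_def by blast
  have "\<not> y \<prec> z" if "y \<in> Q" for y
  proof
    assume "y \<prec> z"
    then have y: "y \<in> Q \<inter> below (Suc k)" using lex_less_below z(1) that by blast
    then have "y k < m \<or> y k = m \<and> y(k := 0) \<prec> z(k := 0)"
      using \<open>y \<prec> z\<close> z(1,2) lex_less_Suc[of y k z] by blast
    moreover have "y k = m \<Longrightarrow> y(k := 0) \<in> P" unfolding P_def using y by blast
    ultimately show False using mle[OF y] z(3) by auto
  qed
  then show ?case using z(1) by blast
qed

lemma Well_order_omega_omega: "Well_order omega_omega"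
  unfolding well_order_on_def linear_order_on_def partial_order_on_def preorder_on_def
proof (intro conjI)
  show "omega_omega \<subseteq> Field omega_omega \<times> Field omega_omega"
    by (auto simp: Field_def)
  show "refl_on (Field omega_omega) omega_omega"
    unfolding Field_omega_omega by (auto simp: refl_on_def omega_omega_eq)
  show "trans omega_omega"
    by (rule transI) (auto simp: omega_omega_eq intro: lex_less_trans)
  show "antisym omega_omega"
    by (rule antisymI) (auto simp: omega_omega_eq dest: lex_less_trans)
  show "total_on (Field omega_omega) omega_omega"
    unfolding Field_omega_omega using lex_less_linear
    by (auto simp: total_on_def omega_omega_eq)
  show "wf (omega_omega - Id)"
  proof (rule wfI_min)
    fix x Q assume "x \<in> (Q :: (nat \<Rightarrow> nat) set)"
    show "\<exists>z\<in>Q. \<forall>y. (y, z) \<in> omega_omega - Id \<longrightarrow> y \<notin> Q"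
    proof (cases "Q \<inter> (\<Union>k. below k) = {}")
      case True
      then show ?thesis using \<open>x \<in> Q\<close> by (auto simp: omega_omega_eq)
    next
      case False
      then obtain q k where "q \<in> Q \<inter> (\<Union>k. below k)" "q \<in> below k" by blast
      from below_has_min[OF Int_lower2 this] show ?thesis by (auto simp: omega_omega_eq)
    qed
  qed
qed

section \<open>Comparison of well-orders with omega^omega\<close>

text \<open>If \<open>z\<close> were the least point with \<open>h z \<prec> z\<close>, monotonicity
  would make \<open>h z\<close> a smaller such point.\<close>

lemma no_descending_self_map:
  assumes "\<And>f. f \<in> B \<Longrightarrow> h f \<in> B" and "B \<subseteq> (\<Union>k. below k)"
    and mono: "\<And>f g. f \<in> B \<Longrightarrow> g \<in> B \<Longrightarrow> f \<prec> g \<Longrightarrow> h f \<prec> h g"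
    and "g \<in> B"
  shows "\<not> h g \<prec> g"
proof
  assume g: "h g \<prec> g"
  let ?Q = "{f \<in> B. h f \<prec> f}"
  obtain k where "g \<in> below k" using assms by blast
  then have "\<exists>z\<in>?Q. \<forall>y\<in>?Q. \<not> y \<prec> z"
    by (intro below_has_min[of _ g]) (use assms g in auto)
  then obtain z where "z \<in> B" "h z \<prec> z" "\<And>y. y \<in> B \<Longrightarrow> h y \<prec> y \<Longrightarrow> \<not> y \<prec> z" by blast
  then show False using assms(1) mono by blast
qed

text \<open>A strictly smaller well-order is isomorphic to the segment below some \<open>a\<close>.
  Only the strictly increasing map and the bound \<open>a\<close> are kept, as
  \<open>no_descending_self_map\<close> asks for nothing more.\<close>

lemma ordLess_obtain_strict_mono:
  assumes "(r, r') \<in> ordLess"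
  obtains a f where "a \<in> Field r'"
    "\<And>x. x \<in> Field r \<Longrightarrow> (f x, a) \<in> r' - Id"
    "\<And>x y. (x, y) \<in> r - Id \<Longrightarrow> (f x, f y) \<in> r' - Id"
proof -
  have wo: "Well_order r" "Well_order r'" using assms by (auto simp: ordLess_def)
  then obtain a where a: "a \<in> Field r'" "(r, Restr r' (underS r' a)) \<in> ordIso"
    using ordLess_iff_ordIso_Restr assms by blast
  then obtain f where f: "iso r (Restr r' (underS r' a)) f" by (auto simp: ordIso_def)
  then have bij: "bij_betw f (Field r) (Field (Restr r' (underS r' a)))"
    and mono: "\<And>x y. (x, y) \<in> r \<Longrightarrow> (f x, f y) \<in> Restr r' (underS r' a)"
    by (auto simp: iso_iff2 Field_def)
  show ?thesis
  proof (rule that[OF a(1)])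
    fix x assume "x \<in> Field r"
    then have "f x \<in> Field (Restr r' (underS r' a))" using bij by (auto simp: bij_betw_def)
    then show "(f x, a) \<in> r' - Id" by (auto simp: Field_def underS_def)
  next
    fix x y assume xy: "(x, y) \<in> r - Id"
    then have "x \<in> Field r" "y \<in> Field r" by (auto simp: Field_def)
    then have "f x \<noteq> f y" using xy bij by (auto simp: bij_betw_def inj_on_def)
    then show "(f x, f y) \<in> r' - Id" using mono xy by auto
  qed
qed

text \<open>Every bounded part of \<open>D\<close> embeds into some omega^k, so \<open>D\<close> is
  well-ordered and not longer than omega^omega; every omega^k embeds into \<open>D\<close>, so it is
  not shorter. Either strict comparison would yield a monotone self-map moving a point down.\<close>

lemma well_ordered_omega_omegaI:
  fixes D :: "real set"
  assumes segment: "\<And>r. \<exists>k e. \<forall>x\<in>D. x \<le> r \<longrightarrow> e x \<in> below k \<and> (\<forall>y\<in>D. y < x \<longrightarrow> e y \<prec> e x)"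
    and powers: "\<And>k. \<exists>h. (\<forall>f\<in>below k. h f \<in> D) \<and> (\<forall>f\<in>below k. \<forall>g\<in>below k. f \<prec> g \<longrightarrow> h f < h g)"
  shows "well_ordered_of_type D omega_omega"
proof -
  have Field: "Field (le_on D) = D" by (auto simp: Field_def le_on_def)
  have "wf (le_on D - Id)"
  proof (rule wfI_min)
    fix x and Q :: "real set"
    assume x: "x \<in> Q"
    show "\<exists>z\<in>Q. \<forall>y. (y, z) \<in> le_on D - Id \<longrightarrow> y \<notin> Q"
    proof (cases "x \<in> D")
      case True
      obtain k e where e': "\<forall>x'\<in>D. x' \<le> x \<longrightarrow> e x' \<in> below k \<and> (\<forall>y\<in>D. y < x' \<longrightarrow> e y \<prec> e x')"
        using segment[of x] by (elim exE)
      have e: "e y \<in> below k" if "y \<in> D" "y \<le> x" for y using e' that by simp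
      have e_mono: "e y \<prec> e z" if "y \<in> D" "z \<in> D" "z \<le> x" "y < z" for y z using e' that by simp
      let ?Q = "{y \<in> Q \<inter> D. y \<le> x}"
      have "\<exists>z\<in>e ` ?Q. \<forall>y\<in>e ` ?Q. \<not> y \<prec> z"
        by (rule below_has_min[of _ "e x" k]) (use True x e in auto)
      then obtain z where z: "z \<in> ?Q" "\<And>y. y \<in> ?Q \<Longrightarrow> \<not> e y \<prec> e z" by blast
      have "y \<notin> Q" if "(y, z) \<in> le_on D - Id" for y
        using that z e_mono[of y z] by (auto simp: le_on_def)
      then show ?thesis using z(1) by blast
    qed (use x in \<open>auto simp: le_on_def\<close>)
  qed
  then have wo: "well_order_on D (le_on D)"
    by (auto simp: well_order_on_def linear_order_on_def partial_order_on_def preorder_on_def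
        refl_on_def trans_def antisym_def total_on_def le_on_def)
  then have wo': "Well_order (le_on D)" by (simp add: Field)
  have "(le_on D, omega_omega) \<notin> ordLess"
  proof
    assume "(le_on D, omega_omega) \<in> ordLess"
    then obtain a f where a: "a \<in> Field omega_omega"
      and fa: "\<And>x. x \<in> Field (le_on D) \<Longrightarrow> (f x, a) \<in> omega_omega - Id"
      and f: "\<And>x y. (x, y) \<in> le_on D - Id \<Longrightarrow> (f x, f y) \<in> omega_omega - Id"
      by (rule ordLess_obtain_strict_mono) (rule that)
    note fa = fa[unfolded Field]
    obtain k where k: "a \<in> below k" using a by (auto simp: Field_omega_omega)
    obtain h where h': "(\<forall>f\<in>below k. h f \<in> D) \<and> (\<forall>f\<in>below k. \<forall>g\<in>below k. f \<prec> g \<longrightarrow> h f < h g)"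
      using powers[of k] by (elim exE)
    have h: "h g \<in> D" if "g \<in> below k" for g using h' that by simp
    have h_mono: "h g < h g'" if "g \<in> below k" "g' \<in> below k" "g \<prec> g'" for g g' using h' that by simp
    \<comment> \<open>All values of \<open>f\<close> lie below \<open>a\<close>, hence in
      \<open>below k\<close>. Going into \<open>D\<close> by \<open>h\<close> and back by
      \<open>f\<close> is therefore a self-map of \<open>below k\<close> that sends \<open>a\<close>
      below itself.\<close>
    have "\<not> (f \<circ> h) a \<prec> a"
    proof (rule no_descending_self_map)
      show "a \<in> below k" by fact
      show "below k \<subseteq> (\<Union>k. below k)" by blast
    next
      fix g assume "g \<in> below k"
      then have "f (h g) \<prec> a" using fa h by (auto simp: omega_omega_eq)
      then show "(f \<circ> h) g \<in> below k" using k lex_less_below by auto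
    next
      fix g g' assume "g \<in> below k" "g' \<in> below k" "g \<prec> g'"
      then show "(f \<circ> h) g \<prec> (f \<circ> h) g'"
        using h[of g] h[of g'] h_mono[of g g'] f[of "h g" "h g'"] by (auto simp: le_on_def omega_omega_eq)
    qed
    moreover have "f (h a) \<prec> a" using fa h k by (auto simp: omega_omega_eq)
    ultimately show False by simp
  qed
  moreover have "(omega_omega, le_on D) \<notin> ordLess"
  proof
    assume "(omega_omega, le_on D) \<in> ordLess"
    then obtain a f where a: "a \<in> Field (le_on D)"
      and fa: "\<And>g. g \<in> Field omega_omega \<Longrightarrow> (f g, a) \<in> le_on D - Id"
      and f: "\<And>g g'. (g, g') \<in> omega_omega - Id \<Longrightarrow> (f g, f g') \<in> le_on D - Id"
      by (rule ordLess_obtain_strict_mono) (rule that)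
    note a = a[unfolded Field]
    obtain k e where e': "\<forall>x'\<in>D. x' \<le> a \<longrightarrow> e x' \<in> below k \<and> (\<forall>y\<in>D. y < x' \<longrightarrow> e y \<prec> e x')"
      using segment[of a] by (elim exE)
    have e: "e y \<in> below k" if "y \<in> D" "y \<le> a" for y using e' that by simp
    have e_mono: "e y \<prec> e z" if "y \<in> D" "z \<in> D" "z \<le> a" "y < z" for y z using e' that by simp
    \<comment> \<open>\<open>u\<close> is omega^k, which exceeds all codes \<open>e (f g)\<close>;
      so \<open>e \<circ> f\<close> moves it down.\<close>
    define u where "u = (\<lambda>_. 0::nat)(k := 1)"
    have u: "u \<in> Field omega_omega" unfolding Field_omega_omega u_def
      by (intro UN_I[of "Suc k"]) (auto simp: below_def)
    have ef: "e (f g) \<in> below k" if "g \<in> Field omega_omega" for g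
      using fa[OF that] e by (auto simp: le_on_def)
    have "\<not> (e \<circ> f) u \<prec> u"
    proof (rule no_descending_self_map)
      show "u \<in> Field omega_omega" by fact
      show "Field omega_omega \<subseteq> (\<Union>k. below k)" by (simp add: Field_omega_omega)
    next
      fix g assume "g \<in> Field omega_omega"
      then show "(e \<circ> f) g \<in> Field omega_omega" using ef by (auto simp: Field_omega_omega)
    next
      fix g g' assume g: "g \<in> Field omega_omega" "g' \<in> Field omega_omega" "g \<prec> g'"
      then have "(g, g') \<in> omega_omega - Id"
        unfolding Field_omega_omega by (auto simp: omega_omega_eq)
      then show "(e \<circ> f) g \<prec> (e \<circ> f) g'"
        using f fa g e_mono[of "f g" "f g'"] by (force simp: le_on_def)
    qed
    moreover have "e (f u) \<prec> u"
      using ef[OF u] by (auto simp: lex_less_def u_def below_def intro!: exI[of _ k])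
    ultimately show False by simp
  qed
  ultimately have "(le_on D, omega_omega) \<in> ordIso"
    using wo' Well_order_omega_omega by (meson not_ordLess_iff_ordLeq ordIso_iff_ordLeq)
  then show ?thesis using wo by (simp add: well_ordered_of_type_def)
qed

subsection \<open>Sparse dyadic numbers\<close>

text \<open>\<open>sparse k\<close> is the set of all sums of at most \<open>k\<close> distinct powers \<open>2\<^sup>-\<^sup>b\<close>, split at the leading one.\<close>

primrec sparse :: "nat \<Rightarrow> real set" where
  "sparse 0 = {0}"
| "sparse (Suc k) = insert 0 {(1/2) ^ b + x |b x. x \<in> sparse k \<and> x < (1/2) ^ b}"

lemma sparse_nonneg: "x \<in> sparse k \<Longrightarrow> 0 \<le> x"
  by (induction k arbitrary: x) (auto intro: add_nonneg_nonneg)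

lemma ex_leading_power:
  assumes "n > (0::nat)"
  obtains e m where "n = 2 ^ e + m" "m < 2 ^ e"
proof -
  obtain e where e: "2 ^ e \<le> n" "n < 2 ^ (e + 1)" using ex_power_ivl1[of 2 n] assms by auto
  show ?thesis by (rule that[of e "n - 2 ^ e"]) (use e in auto)
qed

text \<open>Induction removes the leading binary digit. The bound \<open>n \<le> 2 ^ L\<close> keeps
  its exponent \<open>e\<close> at most \<open>L\<close>, so that \<open>L - e\<close> is a genuine
  difference.\<close>

lemma sparse_dyadic:
  "nu2 n \<le> k \<Longrightarrow> n \<le> 2 ^ L \<Longrightarrow> real n / 2 ^ L \<in> sparse k"
proof (induction k arbitrary: n)
  case 0
  have "n = 0"
  proof (rule ccontr)
    assume "n \<noteq> 0"
    then obtain e m where "n = 2 ^ e + m" "m < 2 ^ e" using ex_leading_power by blast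
    then show False using "0.prems"(1) nu2_add_power[of m e] by simp
  qed
  then show ?case by simp
next
  case (Suc k)
  show ?case
  proof (cases "n = 0")
    case False
    then obtain e m where n: "n = 2 ^ e + m" "m < 2 ^ e" using ex_leading_power by blast
    have "(2::nat) ^ e \<le> 2 ^ L" using n(1) Suc.prems(2) by linarith
    then have "e \<le> L" by (rule power_le_imp_le_exp[rotated]) simp
    have "Suc (nu2 m) \<le> Suc k"
      using Suc.prems(1) nu2_add_power[OF n(2)] unfolding n(1) by linarith
    moreover have "m \<le> 2 ^ L" using n(1) Suc.prems(2) by linarith
    ultimately have "real m / 2 ^ L \<in> sparse k" by (intro Suc.IH) auto
    moreover have "(2::real) ^ L = 2 ^ (L - e) * 2 ^ e"
      using \<open>e \<le> L\<close> by (simp flip: power_add)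
    then have "2 ^ e / 2 ^ L = (1/2 :: real) ^ (L - e)"
      by (simp add: power_one_over)
    moreover have "real m < 2 ^ e" using n(2) of_nat_less_iff[of m "2 ^ e", where 'a = real] by simp
    then have "real m / 2 ^ L < 2 ^ e / 2 ^ L" by (rule divide_strict_right_mono) simp
    moreover have "real n / 2 ^ L = 2 ^ e / 2 ^ L + real m / 2 ^ L"
      using n(1) by (simp add: add_divide_distrib)
    ultimately have "\<exists>b x. real n / 2 ^ L = (1/2) ^ b + x \<and> x \<in> sparse k \<and> x < (1/2) ^ b"
      by (intro exI[of _ "L - e"] exI[of _ "real m / 2 ^ L"]) auto
    then show ?thesis by simp
  qed simp
qed

lemma sparse_imp_dyadic:
  "x \<in> sparse k \<Longrightarrow> \<exists>n L. x = real n / 2 ^ L \<and> nu2 n \<le> k"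
proof (induction k arbitrary: x)
  case 0
  then show ?case by (auto intro!: exI[of _ 0])
next
  case (Suc k)
  show ?case
  proof (cases "x = 0")
    case False
    then obtain b y where x: "x = (1/2) ^ b + y" "y \<in> sparse k" "y < (1/2) ^ b"
      using Suc.prems by auto
    obtain n L where n: "y = real n / 2 ^ L" "nu2 n \<le> k" using Suc.IH[OF x(2)] by blast
    have "real (2 ^ b * n) < real (2 ^ L)" using x(3) n(1) by (simp add: field_simps power_one_over)
    then have "2 ^ b * n < 2 ^ L" by (simp only: of_nat_less_iff)
    \<comment> \<open>Over the common denominator \<open>2 ^ (b + L)\<close> the leading power
      contributes \<open>2 ^ L\<close> and the rest \<open>2 ^ b * n\<close>, which is smaller; the
      digits do not overlap.\<close>
    then have "nu2 (2 ^ L + 2 ^ b * n) = Suc (nu2 n)" by (simp add: nu2_add_power)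
    moreover have "x = real (2 ^ L + 2 ^ b * n) / 2 ^ (b + L)"
      using x(1) n(1) by (simp add: field_simps power_add power_one_over)
    ultimately show ?thesis using n(2) by (metis Suc_le_mono)
  qed (auto intro!: exI[of _ 0])
qed

text \<open>For \<open>b < c\<close> the right side would be below twice \<open>(1/2) ^ c\<close>,
  hence below \<open>(1/2) ^ b\<close>.\<close>

lemma leading_power_mono:
  fixes x y :: real
  assumes "(1/2) ^ b + x < (1/2) ^ c + y" "0 \<le> x" "y < (1/2) ^ c"
  shows "c < b \<or> c = b \<and> x < y"
proof (cases b c rule: linorder_cases)
  case less
  then have "(1/2 :: real) ^ c \<le> (1/2) ^ Suc b" by (intro power_decreasing) auto
  then have False using assms by simp
  then show ?thesis ..
qed (use assms in auto)

text \<open>A larger number has a smaller leading exponent or, for equal exponents, a larger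
  remainder. Hence the exponent serves as the coefficient of omega^(2k), above the code of the
  remainder, and the order is reversed.\<close>

lemma sparse_code:
  "\<exists>e. \<forall>x\<in>sparse k. e x \<in> below (2 * k) \<and> (\<forall>y\<in>sparse k. x < y \<longrightarrow> e y \<prec> e x)"
proof (induction k)
  case 0
  then show ?case by (auto simp: below_def intro!: exI[of _ "\<lambda>_ _. 0"])
next
  case (Suc k)
  then obtain e where e': "\<forall>x\<in>sparse k. e x \<in> below (2 * k) \<and> (\<forall>y\<in>sparse k. x < y \<longrightarrow> e y \<prec> e x)"
    by (elim exE)
  have e: "e x \<in> below (2 * k)" if "x \<in> sparse k" for x using e' that by simp
  have e_mono: "e y \<prec> e x" if "x \<in> sparse k" "y \<in> sparse k" "x < y" for x y using e' that by simp
  have "\<forall>x\<in>sparse (Suc k) - {0}. \<exists>p. x = (1/2) ^ fst p + snd p \<and> snd p \<in> sparse k \<and> snd p < (1/2) ^ fst p"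
    by auto
  then obtain p where p: "\<forall>x\<in>sparse (Suc k) - {0}. x = (1/2) ^ fst (p x) + snd (p x) \<and>
      snd (p x) \<in> sparse k \<and> snd (p x) < (1/2) ^ fst (p x)"
    by (rule bchoice[THEN exE])
  \<comment> \<open>Zero is the least number and must receive the greatest code. Leading exponents
    are unbounded, so this takes the extra power omega^(2k+1); hence two powers of omega per
    digit.\<close>
  define e2 where "e2 x = (if x = 0 then (\<lambda>_. 0)(2 * k + 1 := 1)
      else (e (snd (p x)))(2 * k := fst (p x)))" for x
  have 1: "e2 x \<in> below (Suc (2 * k))" if "x \<in> sparse (Suc k)" "x \<noteq> 0" for x
    using that p e upd_below by (simp add: e2_def del: sparse.simps)
  have "e2 x \<in> below (2 * Suc k)" if "x \<in> sparse (Suc k)" for x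
  proof (cases "x = 0")
    case True
    then show ?thesis by (simp add: e2_def below_def)
  next
    case False
    then show ?thesis using 1[OF that False] below_mono[of "Suc (2 * k)" "2 * Suc k"] by auto
  qed
  moreover have "e2 y \<prec> e2 x" if xy: "x \<in> sparse (Suc k)" "y \<in> sparse (Suc k)" "x < y" for x y
  proof (cases "x = 0")
    case True
    then have "e2 y \<in> below (Suc (2 * k))" using 1 xy by blast
    then show ?thesis using True
      by (auto simp: lex_less_def e2_def below_def intro!: exI[of _ "Suc (2 * k)"])
  next
    case False
    have y: "y \<noteq> 0" using False xy sparse_nonneg by force
    let ?b = "fst (p x)" and ?x = "snd (p x)" and ?c = "fst (p y)" and ?y = "snd (p y)"
    have px: "x = (1/2) ^ ?b + ?x" "?x \<in> sparse k" using p xy(1) False by blast+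
    have py: "y = (1/2) ^ ?c + ?y" "?y \<in> sparse k" "?y < (1/2) ^ ?c" using p xy(2) y by blast+
    have "(1/2) ^ ?b + ?x < (1/2) ^ ?c + ?y" using xy(3) px(1) py(1) by linarith
    then have "?c < ?b \<or> ?c = ?b \<and> ?x < ?y"
      using sparse_nonneg px(2) py(3) by (intro leading_power_mono) auto
    then show ?thesis
      using False y lex_less_upd[OF e[OF py(2)] e[OF px(2)]] e_mono[OF px(2) py(2)]
      by (auto simp: e2_def)
  qed
  ultimately show ?case by blast
qed

subsection \<open>Reversed copies of \<open>\<omega>\<^sup>k\<close>\<close>

text \<open>\<open>descends k S\<close> expresses that the reverse order on \<open>S\<close> contains a copy of \<open>\<omega>\<^sup>k\<close>. In this form
  the indecomposability of \<open>\<omega>\<^sup>k\<close> is a pigeonhole argument (\<open>descends_Un\<close>).\<close>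

primrec descends :: "nat \<Rightarrow> real set \<Rightarrow> bool" where
  "descends 0 S \<longleftrightarrow> S \<noteq> {}"
| "descends (Suc k) S \<longleftrightarrow>
    (\<exists>t. (\<forall>i. t (Suc i) < t i) \<and> (\<forall>i. descends k (S \<inter> {t (Suc i)..<t i})))"

lemma descends_mono: "descends k S \<Longrightarrow> S \<subseteq> S' \<Longrightarrow> descends k S'"
proof (induction k arbitrary: S S')
  case (Suc k)
  then obtain t where t: "\<forall>i. t (Suc i) < t i" "\<And>i. descends k (S \<inter> {t (Suc i)..<t i})" by auto
  have "descends k (S' \<inter> {t (Suc i)..<t i})" for i
    by (rule Suc.IH[OF t(2)]) (use Suc.prems(2) in blast)
  then show ?case using t(1) by auto
qed auto

lemma descends_scale: "descends k S \<Longrightarrow> c > 0 \<Longrightarrow> descends k ((*) c ` S)"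
proof (induction k arbitrary: S)
  case (Suc k)
  then obtain t where t: "\<forall>i. t (Suc i) < t i" "\<And>i. descends k (S \<inter> {t (Suc i)..<t i})" by auto
  have "descends k ((*) c ` S \<inter> {c * t (Suc i)..<c * t i})" for i
    by (rule descends_mono[OF Suc.IH[OF t(2)]]) (use Suc.prems(2) in auto)
  then show ?case using t(1) Suc.prems(2) by (auto intro!: exI[of _ "\<lambda>i. c * t i"])
qed auto

text \<open>Unsuitable intervals can be merged into their neighbours: if \<open>r\<close> enumerates
  the suitable indices, the interval from \<open>t (r (Suc n))\<close> to \<open>t (r n)\<close>
  contains the suitable one that ends at \<open>t (r n)\<close>.\<close>

lemma descends_SucI:
  assumes t: "\<And>i. t (Suc i) < t i" and inf: "infinite {i. descends k (A \<inter> {t (Suc i)..<t i})}"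
  shows "descends (Suc k) A"
proof -
  obtain r :: "nat \<Rightarrow> nat" where "strict_mono r" "\<forall>n. r n \<in> {i. descends k (A \<inter> {t (Suc i)..<t i})}"
    using infinite_enumerate[OF inf] by blast
  then have r: "strict_mono r" "descends k (A \<inter> {t (Suc (r n))..<t (r n)})" for n
    by blast+
  have dec: "t j \<le> t i" if "i \<le> j" for i j
    by (rule lift_Suc_antimono_le[of t, OF less_imp_le[OF t] that])
  have step: "t (r (Suc n)) \<le> t (Suc (r n))" for n
    using strict_monoD[OF r(1), of n "Suc n"] by (intro dec) simp
  have "descends k (A \<inter> {t (r (Suc n))..<t (r n)})" for n
    by (rule descends_mono[OF r(2)]) (use step[of n] in \<open>auto intro: order_trans\<close>)
  moreover have "t (r (Suc n)) < t (r n)" for n using step[of n] t[of "r n"] by linarith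
  ultimately show ?thesis unfolding descends.simps by (intro exI[of _ "\<lambda>n. t (r n)"]) simp
qed

lemma descends_Un: "descends k (A \<union> B) \<Longrightarrow> descends k A \<or> descends k B"
proof (induction k arbitrary: A B)
  case (Suc k)
  then obtain t where t: "\<And>i. t (Suc i) < t i" "\<And>i. descends k ((A \<union> B) \<inter> {t (Suc i)..<t i})"
    by auto
  have "descends k (A \<inter> {t (Suc i)..<t i}) \<or> descends k (B \<inter> {t (Suc i)..<t i})" for i
    using Suc.IH t(2)[of i] unfolding Int_Un_distrib2 by blast
  then have "UNIV = {i. descends k (A \<inter> {t (Suc i)..<t i})} \<union> {i. descends k (B \<inter> {t (Suc i)..<t i})}"
    by auto
  then have "infinite {i. descends k (A \<inter> {t (Suc i)..<t i})} \<or> infinite {i. descends k (B \<inter> {t (Suc i)..<t i})}"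
    by (metis finite_UnI infinite_UNIV_nat)
  then show ?case using descends_SucI[of t] t(1) by blast
qed auto

lemma not_descends_empty: "\<not> descends k {}"
  by (induction k) auto

lemma descends_UN:
  "finite I \<Longrightarrow> descends k (\<Union>i\<in>I. A i) \<Longrightarrow> \<exists>i\<in>I. descends k (A i)"
  by (induction I rule: finite_induct) (auto simp: not_descends_empty dest: descends_Un)

text \<open>Fixing \<open>(1/2) ^ (c + Suc i)\<close> as leading power leaves a translated copy of
  the same situation for \<open>k\<close>, between two consecutive points
  \<open>z + (1/2) ^ (c + i)\<close>. The translation \<open>z\<close> and the cutoff
  \<open>c\<close> are general for the sake of this induction.\<close>

lemma descends_sparse: "descends k ((+) z ` (sparse k \<inter> {..<(1/2) ^ c}))"
proof (induction k arbitrary: z c)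
  case (Suc k)
  define t :: "nat \<Rightarrow> real" where "t i = z + (1/2) ^ (c + i)" for i
  have "descends k ((+) z ` (sparse (Suc k) \<inter> {..<(1/2) ^ c}) \<inter> {t (Suc i)..<t i})" for i
  proof (rule descends_mono[OF Suc.IH])
    show "(+) (t (Suc i)) ` (sparse k \<inter> {..<(1/2) ^ (c + Suc i)})
        \<subseteq> (+) z ` (sparse (Suc k) \<inter> {..<(1/2) ^ c}) \<inter> {t (Suc i)..<t i}"
    proof
      fix x assume "x \<in> (+) (t (Suc i)) ` (sparse k \<inter> {..<(1/2) ^ (c + Suc i)})"
      then obtain u where u: "u \<in> sparse k" "u < (1/2) ^ (c + Suc i)" "x = t (Suc i) + u" by auto
      let ?v = "(1/2) ^ (c + Suc i) + u"
      have v: "?v < (1/2) ^ (c + i)" using u(2) by simp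
      also have "(1/2 :: real) ^ (c + i) \<le> (1/2) ^ c" by (intro power_decreasing) auto
      finally have "?v < (1/2) ^ c" .
      moreover have "?v \<in> sparse (Suc k)" unfolding sparse.simps using u(1,2) by blast
      moreover have "x = z + ?v" by (simp add: u t_def)
      moreover have "x \<in> {t (Suc i)..<t i}"
        using v u(3) sparse_nonneg[OF u(1)] by (simp add: t_def)
      ultimately show "x \<in> (+) z ` (sparse (Suc k) \<inter> {..<(1/2) ^ c}) \<inter> {t (Suc i)..<t i}"
        by blast
    qed
  qed
  then show ?case by (auto simp: t_def intro!: exI[of _ t] simp del: sparse.simps)
qed simp

text \<open>The coefficient at \<open>k\<close> selects an interval, and the embedding given by
  induction places the remainder inside it. Later intervals lie further to the left, so the order is
  reversed.\<close>

lemma descends_embedding: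
  "descends k S \<Longrightarrow>
    \<exists>h. (\<forall>f\<in>below k. h f \<in> S) \<and> (\<forall>f\<in>below k. \<forall>g\<in>below k. f \<prec> g \<longrightarrow> h g < h f)"
proof (induction k arbitrary: S)
  case 0
  then obtain s where "s \<in> S" by auto
  then show ?case by (intro exI[of _ "\<lambda>_. s"]) (auto simp: below_def lex_less_def)
next
  case (Suc k)
  then obtain t where t: "\<And>i. t (Suc i) < t i" "\<And>i. descends k (S \<inter> {t (Suc i)..<t i})" by auto
  have dec: "t j \<le> t i" if "i \<le> j" for i j
    by (rule lift_Suc_antimono_le[of t, OF less_imp_le[OF t(1)] that])
  have "\<forall>i. \<exists>h. (\<forall>f\<in>below k. h f \<in> S \<inter> {t (Suc i)..<t i}) \<and>
      (\<forall>f\<in>below k. \<forall>g\<in>below k. f \<prec> g \<longrightarrow> h g < h f)"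
    using Suc.IH[OF t(2)] by (rule allI)
  then obtain h where h': "\<forall>i. (\<forall>f\<in>below k. h i f \<in> S \<inter> {t (Suc i)..<t i}) \<and>
      (\<forall>f\<in>below k. \<forall>g\<in>below k. f \<prec> g \<longrightarrow> h i g < h i f)"
    by (rule choice[THEN exE])
  have h: "h i f \<in> S \<inter> {t (Suc i)..<t i}" if "f \<in> below k" for i f using h' that by blast
  have h_mono: "h i g < h i f" if "f \<in> below k" "g \<in> below k" "f \<prec> g" for i f g
    using h' that by blast
  show ?case
  proof (intro exI[of _ "\<lambda>f. h (f k) (f(k := 0))"] conjI ballI impI)
    fix f assume "f \<in> below (Suc k)"
    then show "h (f k) (f(k := 0)) \<in> S" using h below_upd by blast
  next
    fix f g assume fg: "f \<in> below (Suc k)" "g \<in> below (Suc k)" "f \<prec> g"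
    then consider "f k < g k" | "f k = g k" "f(k := 0) \<prec> g(k := 0)"
      using lex_less_Suc by blast
    then show "h (g k) (g(k := 0)) < h (f k) (f(k := 0))"
    proof cases
      case 1
      have "h (g k) (g(k := 0)) < t (g k)" using h[OF below_upd[OF fg(2)]] by simp
      also have "\<dots> \<le> t (Suc (f k))" using 1 by (intro dec) simp
      also have "\<dots> \<le> h (f k) (f(k := 0))" using h[OF below_upd[OF fg(1)]] by simp
      finally show ?thesis .
    next
      case 2
      then show ?thesis using h_mono[OF below_upd[OF fg(1)] below_upd[OF fg(2)]] by simp
    qed
  qed
qed

subsection \<open>Defects of admissible sets\<close>

lemma admissible_ell_chain:
  assumes "admissible A" "n \<ge> 1"
  obtains c where "c \<in> A" "addition_chain_for n c" "chain_length c = ell A n"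
proof -
  have "\<exists>r. \<exists>c\<in>A. addition_chain_for n c \<and> chain_length c = r"
    using assms unfolding admissible_def by blast
  from LeastI_ex[OF this] show ?thesis using that unfolding ell_def by blast
qed

lemma ell_le:
  "c \<in> A \<Longrightarrow> addition_chain_for n c \<Longrightarrow> ell A n \<le> chain_length c"
  unfolding ell_def by (rule Least_le) blast

lemma admissible_le_power_ell: "admissible A \<Longrightarrow> n \<ge> 1 \<Longrightarrow> n \<le> 2 ^ ell A n"
  by (metis admissible_ell_chain chain_le_power)

lemma powr_minus_defect:
  "n \<ge> 1 \<Longrightarrow> 2 powr (- defect A n) = real n / 2 ^ ell A n"
  by (simp add: defect_def powr_diff powr_realpow)

lemma defect_eq_log:
  "n \<ge> 1 \<Longrightarrow> defect A n = - log 2 (real n / 2 ^ ell A n)"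
  by (simp add: defect_def log_divide)

text \<open>A defect of at most \<open>r\<close> means a ratio of at least
  \<open>2 powr (- r)\<close>. As the bound of \<open>chain_growth\<close> tends to 0, this leaves
  only \<open>f < F\<close>, with \<open>F\<close> depending on \<open>r\<close> alone.\<close>

lemma bounded_defect_sparse:
  assumes "admissible A"
  shows "\<exists>k. \<forall>n\<ge>1. defect A n \<le> r \<longrightarrow> real n / 2 ^ ell A n \<in> sparse k"
proof -
  have "(\<lambda>f. 9/4 * (7/8) ^ f :: real) \<longlonglongrightarrow> 9/4 * 0"
    by (intro tendsto_mult_left LIMSEQ_realpow_zero) auto
  then have "eventually (\<lambda>f. 9/4 * (7/8) ^ f < (2 powr (- r) :: real)) sequentially"
    by (rule order_tendstoD) simp
  then obtain F where F: "\<And>f. f \<ge> F \<Longrightarrow> 9/4 * (7/8) ^ f < (2 powr (- r) :: real)"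
    by (auto simp: eventually_sequentially)
  have "real n / 2 ^ ell A n \<in> sparse (2 ^ F)" if n: "n \<ge> 1" "defect A n \<le> r" for n
  proof -
    obtain c where "addition_chain_for n c" "chain_length c = ell A n"
      using admissible_ell_chain[OF assms n(1)] by metis
    then obtain f where f: "real n / 2 ^ ell A n \<le> 9/4 * (7/8) ^ f" "nu2 n \<le> 2 ^ f"
      using chain_growth by metis
    have "2 powr (- r) \<le> real n / 2 ^ ell A n"
      using n(2) by (simp flip: powr_minus_defect[OF n(1)])
    then have "f < F" using F[of f] f(1) by (intro not_le_imp_less notI) linarith
    then have "(2::nat) ^ f \<le> 2 ^ F" by (intro power_increasing) auto
    then show ?thesis
      using f(2) admissible_le_power_ell[OF assms n(1)] by (intro sparse_dyadic) linarith
  qed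
  then show ?thesis by blast
qed

text \<open>A number \<open>1 + u\<close> with sparse \<open>u\<close> in [0, 1) is
  \<open>N / 2 ^ (L + K)\<close> for some \<open>N\<close> in \<open>T\<close>; the factor
  \<open>2 ^ K\<close> serves to reach \<open>T\<close> and adds no digits. It differs from the
  ratio of \<open>N\<close> by a power of 2 with only \<open>k + 1\<close> possible values, so
  indecomposability applies.\<close>

lemma descends_ratios:
  assumes A: "admissible A" and T: "\<And>n. n \<ge> 1 \<Longrightarrow> \<exists>K. 2 ^ K * n \<in> T"
  shows "descends k ((\<lambda>n. real n / 2 ^ ell A n) ` T)"
proof -
  let ?E = "(\<lambda>n. real n / 2 ^ ell A n) ` T"
  have "(+) 1 ` (sparse k \<inter> {..<(1/2) ^ 0}) \<subseteq> (\<Union>s\<in>{..k}. (*) (2 ^ s) ` ?E)"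
  proof
    fix x assume "x \<in> (+) 1 ` (sparse k \<inter> {..<(1/2::real) ^ 0})"
    then obtain u where u: "u \<in> sparse k" "u < 1" "x = 1 + u" by auto
    obtain m L where m: "u = real m / 2 ^ L" "nu2 m \<le> k" using sparse_imp_dyadic[OF u(1)] by blast
    have "real m < real (2 ^ L)" using u(2) m(1) by simp
    then have mL: "m < 2 ^ L" by (simp only: of_nat_less_iff)
    obtain K where K: "2 ^ K * (2 ^ L + m) \<in> T" using T[of "2 ^ L + m"] one_le_power[of "2::nat" L] by fastforce
    define N where "N = 2 ^ K * (2 ^ L + m)"
    have N: "2 ^ (L + K) \<le> N" "N < 2 ^ (L + K + 1)"
      using mL by (simp_all add: N_def power_add)
    have "N \<ge> 1" using one_le_power[of "2::nat" "L + K"] N(1) by linarith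
    note N = N this
    have "nu2 N \<le> Suc k" using mL m(2) by (simp add: N_def nu2_add_power)
    moreover have "\<lfloor>log 2 (real N)\<rfloor> = int (L + K)"
      using floor_log_nat_eq_if[OF N(1,2)] by simp
    moreover have "int (ell A N) \<le> \<lfloor>log 2 (real N)\<rfloor> + int (nu2 N) - 1"
      using A N(3) unfolding admissible_def by blast
    ultimately have le: "ell A N \<le> L + K + k" by linarith
    have "(2::nat) ^ (L + K) \<le> 2 ^ ell A N"
      using N(1) admissible_le_power_ell[OF A N(3)] by linarith
    then have ge: "L + K \<le> ell A N" by (rule power_le_imp_le_exp[rotated]) simp
    \<comment> \<open>The excess of \<open>ell A N\<close> over the integer part of
      \<open>log 2 N\<close>: nonnegative because chains at most double, and at most
      \<open>k\<close> because \<open>N\<close> has at most \<open>k + 1\<close> digits 1.\<close>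
    define s where "s = ell A N - (L + K)"
    have s: "ell A N = s + (L + K)" "s \<le> k" using le ge by (auto simp: s_def)
    have "x = 2 ^ s * (real N / 2 ^ ell A N)"
    proof -
      have "x = 2 ^ K * (2 ^ L + real m) / 2 ^ (L + K)"
        unfolding u(3) m(1) by (simp add: power_add add_divide_distrib)
      also have "2 ^ K * (2 ^ L + real m) = real N" by (simp add: N_def)
      also have "real N / 2 ^ (L + K) = 2 ^ s * (real N / 2 ^ ell A N)"
        unfolding s(1) power_add[of _ s] by simp
      finally show ?thesis .
    qed
    moreover have "N \<in> T" using K by (simp add: N_def)
    ultimately show "x \<in> (\<Union>s\<in>{..k}. (*) (2 ^ s) ` ?E)" using s(2) by blast
  qed
  then have "descends k (\<Union>s\<in>{..k}. (*) (2 ^ s) ` ?E)" by (rule descends_mono[OF descends_sparse])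
  then obtain s where "descends k ((*) (2 ^ s) ` ?E)" using descends_UN[OF finite_atMost] by blast
  then have "descends k ((*) (1 / 2 ^ s) ` (*) (2 ^ s) ` ?E)" by (rule descends_scale) simp
  then show ?thesis by (simp add: image_image)
qed

text \<open>The set \<open>T\<close> allows one proof for both theorems: it will be the set of all
  positive integers and the set of stable numbers.\<close>

lemma well_ordered_defect_image:
  assumes A: "admissible A" and T: "\<And>n. n \<ge> 1 \<Longrightarrow> \<exists>K. 2 ^ K * n \<in> T"
    and pos: "\<And>n. n \<in> T \<Longrightarrow> n \<ge> 1"
  shows "well_ordered_of_type (defect A ` T) omega_omega"
proof (rule well_ordered_omega_omegaI)
  fix r :: real
  obtain k where k: "\<And>n. n \<ge> 1 \<Longrightarrow> defect A n \<le> r \<Longrightarrow> real n / 2 ^ ell A n \<in> sparse k"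
    using bounded_defect_sparse[OF A] by blast
  then have sp: "2 powr (- x) \<in> sparse k" if "x \<in> defect A ` T" "x \<le> r" for x
    using that pos by (auto simp: powr_minus_defect)
  obtain e where e: "\<forall>x\<in>sparse k. e x \<in> below (2 * k) \<and> (\<forall>y\<in>sparse k. x < y \<longrightarrow> e y \<prec> e x)"
    using sparse_code[of k] by (elim exE)
  show "\<exists>k e. \<forall>x\<in>defect A ` T. x \<le> r \<longrightarrow>
      e x \<in> below k \<and> (\<forall>y\<in>defect A ` T. y < x \<longrightarrow> e y \<prec> e x)"
  \<comment> \<open>Both \<open>2 powr (- x)\<close> and the code \<open>e\<close> reverse the
    order, so their composition preserves it.\<close>
  proof (intro exI[of _ "2 * k"] exI[of _ "\<lambda>x. e (2 powr (- x))"] ballI impI conjI)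
    fix x assume x: "x \<in> defect A ` T" "x \<le> r"
    then show "e (2 powr (- x)) \<in> below (2 * k)" using e sp by blast
    fix y assume y: "y \<in> defect A ` T" "y < x"
    then have "2 powr (- x) < 2 powr (- y)" by simp
    moreover have "2 powr (- y) \<in> sparse k" using sp y x by simp
    ultimately show "e (2 powr (- y)) \<prec> e (2 powr (- x))" using e sp[OF x] by blast
  qed
next
  fix k
  let ?E = "(\<lambda>n. real n / 2 ^ ell A n) ` T"
  have ratios: "descends k ?E" using A T by (rule descends_ratios)
  obtain h where h: "\<forall>f\<in>below k. h f \<in> ?E" "\<forall>f\<in>below k. \<forall>g\<in>below k. f \<prec> g \<longrightarrow> h g < h f"
    using descends_embedding[OF ratios] by (elim exE conjE)
  have E: "x > 0" "- log 2 x \<in> defect A ` T" if "x \<in> ?E" for x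
    using that pos defect_eq_log by fastforce+
  show "\<exists>h. (\<forall>f\<in>below k. h f \<in> defect A ` T) \<and>
      (\<forall>f\<in>below k. \<forall>g\<in>below k. f \<prec> g \<longrightarrow> h f < h g)"
  proof (intro exI[of _ "\<lambda>f. - log 2 (h f)"] conjI ballI impI)
    fix f assume "f \<in> below k"
    then show "- log 2 (h f) \<in> defect A ` T" using h(1) E(2) by blast
  next
    fix f g assume "f \<in> below k" "g \<in> below k" "f \<prec> g"
    then have "h g < h f" "0 < h g" using h E(1) by blast+
    then show "- log 2 (h f) < - log 2 (h g)" by simp
  qed
qed

text \<open>Take \<open>K\<close> minimising \<open>ell A (2 ^ K * n) - K\<close>. Minimality gives
  one inequality of stability, and repeated use of the doubling condition of admissibility gives the
  other.\<close>

lemma ex_stable_multiple: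
  assumes A: "admissible A" and n: "n \<ge> 1"
  shows "\<exists>K. stable A (2 ^ K * n)"
proof -
  have pos: "2 ^ K * n \<ge> 1" for K using n by (simp add: Suc_le_eq)
  \<comment> \<open>This makes the truncated subtraction in the minimised quantity a true
    difference.\<close>
  have ge: "K \<le> ell A (2 ^ K * n)" for K
  proof -
    have "(2::nat) ^ K \<le> 2 ^ K * n" using n by simp
    also have "\<dots> \<le> 2 ^ ell A (2 ^ K * n)" using admissible_le_power_ell[OF A pos] .
    finally show ?thesis by (rule power_le_imp_le_exp[rotated]) simp
  qed
  obtain K where K: "\<And>J. ell A (2 ^ K * n) - K \<le> ell A (2 ^ J * n) - J"
    using ex_has_least_nat[of "\<lambda>_. True" _ "\<lambda>K. ell A (2 ^ K * n) - K"] by auto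
  have "ell A (2 ^ k * (2 ^ K * n)) = ell A (2 ^ K * n) + k" for k
  proof (rule antisym)
    show "ell A (2 ^ k * (2 ^ K * n)) \<le> ell A (2 ^ K * n) + k"
    proof (induction k)
      case (Suc k)
      have "2 ^ k * (2 ^ K * n) \<ge> 1" using pos[of "k + K"] by (simp add: power_add mult.assoc)
      then have "ell A (2 * (2 ^ k * (2 ^ K * n))) \<le> ell A (2 ^ k * (2 ^ K * n)) + 1"
        using A unfolding admissible_def by blast
      then show ?case using Suc by (simp add: mult.assoc)
    qed simp
    show "ell A (2 ^ K * n) + k \<le> ell A (2 ^ k * (2 ^ K * n))"
      using K[of "k + K"] ge[of K] ge[of "k + K"] by (simp add: power_add mult.assoc)
  qed
  then show ?thesis using pos by (auto simp: stable_def)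
qed

subsection \<open>Admissibility of all chains and of star chains\<close>

lemma addition_chain_append:
  assumes c: "addition_chain_for n c" and i: "i < length c"
  shows "addition_chain_for (n + c ! i) (c @ [n + c ! i])"
  unfolding addition_chain_for_def
proof (intro conjI allI impI)
  show "hd (c @ [n + c ! i]) = 1" using c by (auto simp: addition_chain_for_def)
  fix k assume k: "1 \<le> k \<and> k < length (c @ [n + c ! i])"
  show "\<exists>ia<k. \<exists>j<k. (c @ [n + c ! i]) ! k = (c @ [n + c ! i]) ! ia + (c @ [n + c ! i]) ! j"
  proof (cases "k < length c")
    case True
    then obtain i' j where "i' < k" "j < k" "c ! k = c ! i' + c ! j"
      using c k unfolding addition_chain_for_def by blast
    then show ?thesis using True by (intro exI[of _ i'] conjI exI[of _ j]) (auto simp: nth_append)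
  next
    case False
    then have "k = length c" using k by simp
    moreover have "n = c ! (length c - 1)" "length c > 0"
      using c by (auto simp: addition_chain_for_def last_conv_nth)
    ultimately show ?thesis using i
      by (intro exI[of _ "length c - 1"] conjI exI[of _ i]) (auto simp: nth_append)
  qed
qed auto

text \<open>The appended sum involves the last element \<open>n\<close>, so the new step is a star
  step.\<close>

lemma star_chain_append:
  assumes c: "c \<in> star_chains" "addition_chain_for n c" and i: "i < length c"
  shows "c @ [n + c ! i] \<in> star_chains"
proof -
  have "\<exists>ia<k. (c @ [n + c ! i]) ! k = (c @ [n + c ! i]) ! (k - 1) + (c @ [n + c ! i]) ! ia"
    if k: "1 \<le> k" "k < length (c @ [n + c ! i])" for k
  proof (cases "k < length c")
    case True
    then obtain i' where "i' < k" "c ! k = c ! (k - 1) + c ! i'"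
      using c k unfolding star_chains_def by blast
    then show ?thesis using True k by (intro exI[of _ i']) (auto simp: nth_append)
  next
    case False
    then have "k = length c" using k by simp
    moreover have "n = c ! (length c - 1)" "length c > 0"
      using c by (auto simp: addition_chain_for_def last_conv_nth)
    ultimately show ?thesis using i by (intro exI[of _ i]) (auto simp: nth_append)
  qed
  moreover have "c @ [n + c ! i] \<in> addition_chains"
    using addition_chain_append[OF c(2) i] by (auto simp: addition_chains_def)
  ultimately show ?thesis by (simp add: star_chains_def)
qed

text \<open>Appending the last element plus some element covers both operations of the binary
  method, doubling and adding 1. Doubling at the end of a shortest chain gives the second condition
  of admissibility.\<close>

lemma admissibleI:
  assumes sub: "A \<subseteq> addition_chains" and one: "[1] \<in> A"
    and append: "\<And>c n i. c \<in> A \<Longrightarrow> addition_chain_for n c \<Longrightarrow> i < length c \<Longrightarrow> c @ [n + c ! i] \<in> A"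
  shows "admissible A"
proof -
  have double: "\<exists>d\<in>A. addition_chain_for (2 * n) d \<and> chain_length d = chain_length c + 1"
    if c: "c \<in> A" "addition_chain_for n c" for c n
  proof -
    have i: "length c - 1 < length c" and n: "n + c ! (length c - 1) = 2 * n"
      using c(2) by (auto simp: addition_chain_for_def last_conv_nth)
    show ?thesis
      using append[OF c i] addition_chain_append[OF c(2) i] i unfolding n
      by (intro bexI[of _ "c @ [2 * n]"]) (auto simp: chain_length_def)
  qed
  \<comment> \<open>The binary method attains the bound exactly: passing from \<open>n div 2\<close>
    to \<open>n\<close> costs one doubling and, for odd \<open>n\<close>, one addition of the
    initial element 1.\<close>
  have binary: "\<exists>c\<in>A. addition_chain_for n c \<and> int (chain_length c) = \<lfloor>log 2 (real n)\<rfloor> + int (nu2 n) - 1"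
    if "n \<ge> 1" for n
    using that
  proof (induction n rule: less_induct)
    case (less n)
    show ?case
    proof (cases "n = 1")
      case True
      then show ?thesis using one nu2_Suc_double[of 0]
        by (intro bexI[of _ "[1]"]) (auto simp: addition_chain_for_def chain_length_def)
    next
      case False
      define m where "m = n div 2"
      have m: "m < n" "m \<ge> 1" using False less.prems by (auto simp: m_def)
      have log: "\<lfloor>log 2 (real n)\<rfloor> = \<lfloor>log 2 (real m)\<rfloor> + 1"
        unfolding m_def using False less.prems by (intro floor_log2_div2) simp
      obtain c where "c \<in> A" "addition_chain_for m c"
        "int (chain_length c) = \<lfloor>log 2 (real m)\<rfloor> + int (nu2 m) - 1"
        using less.IH[OF m] by blast
      then obtain d where d: "d \<in> A" "addition_chain_for (2 * m) d"
        "int (chain_length d) = \<lfloor>log 2 (real n)\<rfloor> + int (nu2 m) - 1"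
        using double log by fastforce
      show ?thesis
      proof (cases "even n")
        case True
        then have "n = 2 * m" by (simp add: m_def)
        then show ?thesis using d by auto
      next
        case False
        then have n: "n = Suc (2 * m)" by (simp add: m_def)
        have d0: "d ! 0 = 1" "0 < length d"
          using d(2) by (auto simp: addition_chain_for_def hd_conv_nth)
        then have eq: "2 * m + d ! 0 = n" by (simp add: n)
        have "nu2 n = Suc (nu2 m)" by (simp add: n)
        moreover have "int (chain_length (d @ [n])) = int (chain_length d) + 1"
          using d0(2) by (cases d) (simp_all add: chain_length_def)
        ultimately show ?thesis
          using append[OF d(1,2) d0(2)] addition_chain_append[OF d(2) d0(2)] d(3) unfolding eq
          by (intro bexI[of _ "d @ [n]"]) auto
      qed
    qed
  qed
  have "\<exists>c\<in>A. addition_chain_for n c \<and> chain_length c = ell A n" if "n \<ge> 1" for n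
    unfolding ell_def by (rule LeastI_ex) (use binary[OF that] in blast)
  then have "ell A (2 * n) \<le> ell A n + 1" if "n \<ge> 1" for n
    using double ell_le that by metis
  moreover have "int (ell A n) \<le> \<lfloor>log 2 (real n)\<rfloor> + int (nu2 n) - 1" if n: "n \<ge> 1" for n
  proof -
    obtain c where "c \<in> A" "addition_chain_for n c"
      and len: "int (chain_length c) = \<lfloor>log 2 (real n)\<rfloor> + int (nu2 n) - 1"
      using binary[OF n] by blast
    then have "ell A n \<le> chain_length c" by (intro ell_le)
    then show ?thesis using len by linarith
  qed
  ultimately show ?thesis using sub binary unfolding admissible_def by blast
qed

lemma singleton_addition_chain: "[1] \<in> addition_chains"
  by (auto simp: addition_chains_def addition_chain_for_def)

lemma admissible_addition_chains: "admissible addition_chains"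
proof (rule admissibleI)
  show "c @ [n + c ! i] \<in> addition_chains" if "addition_chain_for n c" "i < length c" for c n i
    using addition_chain_append[OF that] by (auto simp: addition_chains_def)
qed (use singleton_addition_chain in auto)

lemma admissible_star_chains: "admissible star_chains"
proof (rule admissibleI)
  show "[1] \<in> star_chains" using singleton_addition_chain by (simp add: star_chains_def)
  show "star_chains \<subseteq> addition_chains" unfolding star_chains_def by blast
qed (rule star_chain_append)

theorem theorem1p14:
  shows "(\<forall>A. admissible A \<longrightarrow>
            well_ordered_of_type (defects A) omega_omega \<and>
            well_ordered_of_type (stable_defects A) omega_omega) \<and>
         well_ordered_of_type (defects addition_chains) omega_omega \<and>
         well_ordered_of_type (defects star_chains) omega_omega \<and>
         well_ordered_of_type (stable_defects addition_chains) omega_omega \<and>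
         well_ordered_of_type (stable_defects star_chains) omega_omega"
proof -
  have "well_ordered_of_type (defects A) omega_omega" if A: "admissible A" for A
  proof -
    have "\<exists>K. 2 ^ K * n \<in> {1..}" if "n \<ge> 1" for n :: nat
      using that by (intro exI[of _ 0]) simp
    then have "well_ordered_of_type (defect A ` {1..}) omega_omega"
      by (rule well_ordered_defect_image[OF A]) auto
    moreover have "defects A = defect A ` {1..}" by (auto simp: defects_def)
    ultimately show ?thesis by simp
  qed
  moreover have "well_ordered_of_type (stable_defects A) omega_omega" if A: "admissible A" for A
  proof -
    have "well_ordered_of_type (defect A ` Collect (stable A)) omega_omega"
      using ex_stable_multiple[OF A] by (intro well_ordered_defect_image[OF A]) (auto simp: stable_def)
    moreover have "stable_defects A = defect A ` Collect (stable A)"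
      by (auto simp: stable_defects_def)
    ultimately show ?thesis by simp
  qed
  ultimately show ?thesis using admissible_addition_chains admissible_star_chains by blast
qed

end
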